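(* Let $X$ be a real random variable whose mean $m = E[X]$ and variance $\mathrm{Var}[X]$ exist (are finite), and let $g$ be a real polynomial of degree $3$. If $E[(X-m)^3] = 0$ (in particular this third central moment exists), then the statistical differential approximation for the expected value of $g(X)$ is exact, i.e. $$E[g(X)] = g(m) + \frac{g''(m)}{2!}\,\mathrm{Var}[X].$$
   Context: For a real random variable $X$ with mean $m=E[X]$ and finite variance, and a real function $g$, the statistical differential approximation for $E[g(X)]$ is $E[g(X)] \cong g(m) + \frac{g''(m)}{2!}\mathrm{Var}[X]$, obtained by truncating the Taylor expansion of $g$ about $m$ and taking expectations. It is called exact if equality holds. *)

theory Defs
  imports "HOL-Probability.Probability" "HOL-Computational_Algebra.Polynomial"
begin

definition stat_diff_approx :: "'a measure \<Rightarrow> ('a \<Rightarrow> real) \<Rightarrow> (real \<Rightarrow> real) \<Rightarrow> real" where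
  "stat_diff_approx M X g =
     (let m = prob_space.expectation M X
      in g m + (deriv ^^ 2) g m / fact 2 * prob_space.variance M X)"

(* The Bochner integral of a non-integrable function is 0, so the existence of the
   expected value of g(X) has to be required explicitly. *)
definition stat_diff_exact :: "'a measure \<Rightarrow> ('a \<Rightarrow> real) \<Rightarrow> (real \<Rightarrow> real) \<Rightarrow> bool" where
  "stat_diff_exact M X g \<longleftrightarrow>
     integrable M (\<lambda>\<omega>. g (X \<omega>)) \<and>
     prob_space.expectation M (\<lambda>\<omega>. g (X \<omega>)) = stat_diff_approx M X g"

end

theory Submission
  imports Defs
begin

text \<open>
  Recentred at the mean \<open>m\<close>, a cubic \<open>g\<close> is exactly its Taylor polynomial of order three
  (\<open>poly_taylor_expansion\<close>), so \<open>g (X)\<close> is a linear combination of the centred powers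
  \<open>(X - m) ^ i\<close> with \<open>i \<le> 3\<close>.
  The expectations of these powers are \<open>1\<close>, \<open>0\<close>, the variance, and the third central moment.
  The linear term drops out because \<open>m\<close> is the mean, the cubic one by hypothesis, and the
  truncation after the quadratic term therefore loses nothing. The lemma \<open>higher_deriv_poly\<close>
  turns the analytic \<open>g'' m\<close> into the formal derivative that gives the quadratic coefficient.
\<close>

text \<open>
  Substituting \<open>a + t\<close> for the variable turns derivatives at \<open>a\<close> into derivatives at \<open>0\<close>,
  and those are read off the coefficients.
\<close>
lemma poly_taylor_expansion:
  fixes p :: "'a::field_char_0 poly"
  shows "poly p x = (\<Sum>i\<le>degree p. poly ((pderiv ^^ i) p) a / fact i * (x - a) ^ i)"
proof -
  let ?q = "pcompose p [:a, 1:]"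
  have shift: "(pderiv ^^ i) ?q = pcompose ((pderiv ^^ i) p) [:a, 1:]" for i
    by (induction i) (simp_all add: pderiv_pcompose pderiv_pCons)
  have coeff_q: "coeff ?q i = poly ((pderiv ^^ i) p) a / fact i" for i
  proof -
    have "fact i * coeff ?q i = coeff ((pderiv ^^ i) ?q) 0"
      by (simp add: coeff_higher_pderiv pochhammer_fact)
    also have "\<dots> = poly ((pderiv ^^ i) p) a"
      by (simp add: shift poly_pcompose flip: poly_0_coeff_0)
    finally show ?thesis
      by (simp add: field_simps)
  qed
  have "poly p x = poly ?q (x - a)"
    by (simp add: poly_pcompose)
  also have "\<dots> = (\<Sum>i\<le>degree p. coeff ?q i * (x - a) ^ i)"
    by (simp add: poly_altdef degree_pcompose)
  finally show ?thesis
    by (simp add: coeff_q)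
qed

lemma higher_deriv_poly:
  fixes p :: "'a::real_normed_field poly"
  shows "(deriv ^^ n) (poly p) = poly ((pderiv ^^ n) p)"
proof (induction n)
  case (Suc n)
  have "deriv (poly q) = poly (pderiv q)" for q :: "'a poly"
    by (intro ext DERIV_imp_deriv poly_DERIV)
  with Suc show ?case by simp
qed simp

theorem proposition2:
  fixes M :: "'a measure" and X :: "'a \<Rightarrow> real" and g :: "real poly" and m :: real
  assumes "prob_space M"
    and "X \<in> borel_measurable M"
    and "integrable M X"
    and m: "m = prob_space.expectation M X"
    and "integrable M (\<lambda>\<omega>. (X \<omega> - m) ^ 2)"
    and "degree g = 3"
    and "integrable M (\<lambda>\<omega>. (X \<omega> - m) ^ 3)"
    and "prob_space.expectation M (\<lambda>\<omega>. (X \<omega> - m) ^ 3) = 0"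
  shows "stat_diff_exact M X (poly g)"
proof -
  interpret prob_space M by fact
  define c where "c i = poly ((pderiv ^^ i) g) m / fact i" for i
  have g_X: "poly g (X \<omega>) = c 0 + c 1 * (X \<omega> - m) + c 2 * (X \<omega> - m) ^ 2 + c 3 * (X \<omega> - m) ^ 3"
    for \<omega>
    using poly_taylor_expansion[of g "X \<omega>" m] \<open>degree g = 3\<close>
    by (simp add: c_def eval_nat_numeral)
  have int1: "integrable M (\<lambda>\<omega>. X \<omega> - m)"
    using \<open>integrable M X\<close> by simp
  have centred: "expectation (\<lambda>\<omega>. X \<omega> - m) = 0"
    using \<open>integrable M X\<close> by (simp add: m prob_space)
  have "integrable M (\<lambda>\<omega>. poly g (X \<omega>))"
    unfolding g_X using int1 assms(5,7) by simp
  moreover have "expectation (\<lambda>\<omega>. poly g (X \<omega>)) = c 0 + c 2 * expectation (\<lambda>\<omega>. (X \<omega> - m) ^ 2)"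
    unfolding g_X using int1 assms(5,7,8) centred by (simp add: prob_space)
  moreover have "stat_diff_approx M X (poly g) = c 0 + c 2 * expectation (\<lambda>\<omega>. (X \<omega> - m) ^ 2)"
    by (simp only: stat_diff_approx_def Let_def higher_deriv_poly c_def flip: m) simp
  ultimately show ?thesis
    by (simp add: stat_diff_exact_def)
qed

end
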